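(* Let $H=(V,E)$ be a $(d,k)$-regular hypergraph on $n=|V|$ vertices with adjacency matrix $A$, let $\lambda_1\geq\cdots\geq\lambda_n$ be the eigenvalues of $A$ and $\lambda=\max\{\lambda_2,|\lambda_n|\}$. Then for any nonempty subset $S\subset V$, $$\frac{|N(S)|}{|S|}\geq \frac{1}{1-\left(1-\frac{\lambda^2}{d^2(k-1)^2}\right)\left(1-\frac{|S|}{n}\right)}.$$
   Context: A hypergraph $H=(V,E)$ consists of a finite vertex set $V$ and a set $E$ of hyperedges, each a nonempty subset of $V$; it is $(d,k)$-regular if every hyperedge has exactly $k$ vertices and every vertex lies in exactly $d$ hyperedges. The adjacency matrix $A$ of $H$ has $A_{ii}=0$ and, for $i\neq j$, $A_{ij}$ equal to the number of hyperedges containing both $i$ and $j$. For $S\subset V$, the neighborhood set is $N(S):=\{i\in V: \text{there exists } j\in S \text{ such that } \{i,j\}\subset e \text{ for some } e\in E\}$. *)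

theory Defs
  imports
    "Jordan_Normal_Form.Char_Poly"
    "HOL-Library.Multiset"
begin

definition hypergraph :: "'a set \<Rightarrow> 'a set set \<Rightarrow> bool" where
  "hypergraph V E \<longleftrightarrow> finite V \<and> (\<forall>e\<in>E. e \<noteq> {} \<and> e \<subseteq> V)"

definition regular_hypergraph :: "nat \<Rightarrow> nat \<Rightarrow> 'a set \<Rightarrow> 'a set set \<Rightarrow> bool" where
  "regular_hypergraph d k V E \<longleftrightarrow>
     hypergraph V E \<and> (\<forall>e\<in>E. card e = k) \<and> (\<forall>v\<in>V. card {e\<in>E. v \<in> e} = d)"

text \<open>The list \<open>vs\<close> enumerates the vertices without repetition and fixes the order of
  rows and columns; the characteristic polynomial does not depend on this order.\<close>

definition adjacency_matrix :: "'a set set \<Rightarrow> 'a list \<Rightarrow> real mat" where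
  "adjacency_matrix E vs = mat (length vs) (length vs)
     (\<lambda>(i, j). if i = j then 0 else real (card {e\<in>E. vs ! i \<in> e \<and> vs ! j \<in> e}))"

text \<open>The real eigenvalues, repeated according to algebraic multiplicity, in decreasing
  order. For a symmetric real matrix of dimension \<open>n\<close> the list has length \<open>n\<close>, and its
  entry at index \<open>i - 1\<close> is the \<open>i\<close>-th largest eigenvalue.\<close>

definition eigenvalues_desc :: "real mat \<Rightarrow> real list" where
  "eigenvalues_desc A = rev (sorted_list_of_multiset (proots (char_poly A)))"

lemma set_eigenvalues_desc:
  assumes "A \<in> carrier_mat n n"
  shows "set (eigenvalues_desc A) = {x. eigenvalue A x}"
proof -
  have "char_poly A \<noteq> 0"
    using degree_monic_char_poly[OF assms] by auto
  then show ?thesis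
    by (simp add: eigenvalues_desc_def eigenvalue_root_char_poly[OF assms])
qed

text \<open>The case \<open>i = j\<close> is not excluded, so a vertex of \<open>S\<close> lying on some hyperedge
  belongs to the neighborhood of \<open>S\<close>.\<close>

definition neighborhood :: "'a set \<Rightarrow> 'a set set \<Rightarrow> 'a set \<Rightarrow> 'a set" where
  "neighborhood V E S = {i\<in>V. \<exists>j\<in>S. \<exists>e\<in>E. {i, j} \<subseteq> e}"

end

theory Submission
  imports
    Defs
    "HOL-Analysis.Function_Topology"
    "HOL-Analysis.Convex"
    "HOL-Computational_Algebra.Fundamental_Theorem_Algebra"
begin

text \<open>Let \<open>D = d (k - 1)\<close>, the common row sum of \<open>A\<close>, and \<open>s = |S|\<close>. The vector \<open>A 1\<^sub>S\<close> is
  supported on \<open>N(S)\<close> and has entry sum \<open>D s\<close>, so \<open>D\<^sup>2 s\<^sup>2 \<le> |N(S)| |A 1\<^sub>S|\<^sup>2\<close> by Cauchy--Schwarz.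
  Splitting \<open>1\<^sub>S\<close> into its mean and a part orthogonal to the constants gives
  \<open>|A 1\<^sub>S|\<^sup>2 \<le> D\<^sup>2 s\<^sup>2 / n + \<lambda>\<^sup>2 (s - s\<^sup>2 / n)\<close>.

  The norm of \<open>A\<close> on the vectors orthogonal to the constants is \<open>|r|\<close> for an eigenvalue \<open>r\<close> of
  \<open>A\<close> with an eigenvector there (a maximiser of \<open>|A w|\<close> on the unit sphere). Deflating the constant
  eigenvector shows that \<open>D\<close> and \<open>r\<close> together are roots of the characteristic polynomial, counted
  with multiplicity; as \<open>|r| \<le> D\<close>, either \<open>r \<le> \<lambda>\<^sub>2\<close> or \<open>r < 0\<close> and \<open>\<lambda>\<^sub>n \<le> r\<close>.\<close>

section \<open>The norm on the orthogonal complement of the constants\<close>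

text \<open>Vectors and matrices are plain functions on \<open>nat\<close>, so that compactness can
  come from the product topology; only indices below \<open>n\<close> enter the sum.\<close>

definition kernel_apply :: "nat \<Rightarrow> (nat \<Rightarrow> nat \<Rightarrow> real) \<Rightarrow> (nat \<Rightarrow> real) \<Rightarrow> nat \<Rightarrow> real" where
  "kernel_apply n a f i = (\<Sum>j<n. a i j * f j)"

lemma kernel_apply_add:
  "kernel_apply n a (\<lambda>i. f i + g i) i = kernel_apply n a f i + kernel_apply n a g i"
  by (simp add: kernel_apply_def algebra_simps sum.distrib)

lemma kernel_apply_scale: "kernel_apply n a (\<lambda>i. c * f i) i = c * kernel_apply n a f i"
  by (simp add: kernel_apply_def sum_distrib_left algebra_simps)

lemma kernel_apply_cong:
  assumes "\<And>j. j < n \<Longrightarrow> f j = g j"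
  shows "kernel_apply n a f i = kernel_apply n a g i"
  using assms by (simp add: kernel_apply_def)

lemma kernel_apply_adjoint:
  assumes sym: "\<And>i j. i < n \<Longrightarrow> j < n \<Longrightarrow> a i j = a j i"
  shows "(\<Sum>i<n. kernel_apply n a f i * g i) = (\<Sum>i<n. f i * kernel_apply n a g i)"
proof -
  have "(\<Sum>i<n. kernel_apply n a f i * g i) = (\<Sum>i<n. \<Sum>j<n. a i j * f j * g i)"
    by (simp add: kernel_apply_def sum_distrib_right)
  also have "\<dots> = (\<Sum>j<n. \<Sum>i<n. a i j * f j * g i)"
    by (rule sum.swap)
  also have "\<dots> = (\<Sum>j<n. \<Sum>i<n. f j * (a j i * g i))"
    by (intro sum.cong refl) (use sym in \<open>simp add: algebra_simps\<close>)
  finally show ?thesis by (simp add: kernel_apply_def sum_distrib_left)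
qed

text \<open>Pair the image with the constant vector and move the matrix across. In particular
  vectors of sum 0 are mapped to vectors of sum 0.\<close>

lemma sum_kernel_apply:
  assumes sym: "\<And>i j. i < n \<Longrightarrow> j < n \<Longrightarrow> a i j = a j i"
    and row: "\<And>i. i < n \<Longrightarrow> (\<Sum>j<n. a i j) = D"
  shows "(\<Sum>i<n. kernel_apply n a f i) = D * (\<Sum>i<n. f i)"
  using kernel_apply_adjoint[of n a f "\<lambda>_. 1", OF sym] row
  by (simp add: kernel_apply_def[of n a "\<lambda>_. 1"] sum_distrib_left mult.commute)

text \<open>A continuous function attains its maximum on a compact sphere, and homogeneity carries
  the bound to every \<open>g\<close>. The vector \<open>f\<close> witnesses that the sphere is
  nonempty.\<close>

lemma kernel_apply_max_on_sphere:
  fixes f :: "nat \<Rightarrow> real"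
  assumes f: "(\<Sum>i<n. f i) = 0" "(\<Sum>i<n. (f i)\<^sup>2) \<noteq> 0"
  obtains w where "(\<Sum>i<n. w i) = 0" "(\<Sum>i<n. (w i)\<^sup>2) = 1"
    "\<And>g. (\<Sum>i<n. g i) = 0 \<Longrightarrow>
       (\<Sum>i<n. (kernel_apply n a g i)\<^sup>2) \<le> (\<Sum>i<n. (kernel_apply n a w i)\<^sup>2) * (\<Sum>i<n. (g i)\<^sup>2)"
proof -
  \<comment> \<open>The box bounds every coordinate, also those from \<open>n\<close> on, which the
    two equations in \<open>K\<close> leave free; it is compact by Tychonoff.\<close>
  define P :: "(nat \<Rightarrow> real) set" where "P = PiE UNIV (\<lambda>_. {-1..1})"
  define K where "K = P \<inter> {g. (\<Sum>i<n. g i) = 0} \<inter> {g. (\<Sum>i<n. (g i)\<^sup>2) = 1}"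
  define Q where "Q g = (\<Sum>i<n. (kernel_apply n a g i)\<^sup>2)" for g
  have "compact P"
    unfolding P_def using compactin_PiE[of "\<lambda>_. euclidean" UNIV "\<lambda>_::nat. {-1..1::real}"]
    by (simp add: euclidean_product_topology)
  moreover have "closed {g :: nat \<Rightarrow> real. (\<Sum>i<n. g i) = 0}"
    "closed {g :: nat \<Rightarrow> real. (\<Sum>i<n. (g i)\<^sup>2) = 1}"
    by (intro closed_Collect_eq continuous_intros continuous_on_product_coordinates)+
  ultimately have K: "compact K"
    unfolding K_def by (intro compact_Int_closed)
  have cont: "continuous_on K Q"
    unfolding Q_def kernel_apply_def
    by (intro continuous_intros continuous_on_subset[OF continuous_on_product_coordinates]) auto
  have scaled: "\<exists>h\<in>K. (\<forall>i<n. g i = sqrt (\<Sum>i<n. (g i)\<^sup>2) * h i)"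
    if g: "(\<Sum>i<n. g i) = 0" "(\<Sum>i<n. (g i)\<^sup>2) \<noteq> 0" for g
  proof -
    define c where "c = sqrt (\<Sum>i<n. (g i)\<^sup>2)"
    have nonneg: "(\<Sum>i<n. (g i)\<^sup>2) \<ge> 0" by (intro sum_nonneg) auto
    then have c: "c > 0" and c2: "c\<^sup>2 = (\<Sum>i<n. (g i)\<^sup>2)"
      using g(2) by (auto simp: c_def)
    \<comment> \<open>The zeros from \<open>n\<close> on keep \<open>h\<close> inside the
      box.\<close>
    define h where "h i = (if i < n then g i / c else 0)" for i
    have "(\<Sum>i<n. h i) = (\<Sum>i<n. g i) / c" by (simp add: h_def sum_divide_distrib)
    then have h0: "(\<Sum>i<n. h i) = 0" using g by simp
    have "(\<Sum>i<n. (h i)\<^sup>2) = (\<Sum>i<n. (g i)\<^sup>2) / c\<^sup>2"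
      by (simp add: h_def sum_divide_distrib power_divide)
    then have h1: "(\<Sum>i<n. (h i)\<^sup>2) = 1" using c2 c g by simp
    have "\<bar>h i\<bar> \<le> 1" for i
    proof (cases "i < n")
      case True
      then have "(h i)\<^sup>2 \<le> (\<Sum>i<n. (h i)\<^sup>2)"
        by (intro member_le_sum) auto
      then show ?thesis by (simp add: h1 abs_square_le_1)
    qed (simp add: h_def)
    then have "h \<in> K" using h0 h1 by (auto simp: K_def P_def abs_le_iff minus_le_iff)
    then show ?thesis unfolding c_def[symmetric] using c
      by (intro bexI[of _ h]) (auto simp: h_def)
  qed
  have "K \<noteq> {}" using scaled[OF f] by auto
  then obtain w where w: "w \<in> K" "\<And>h. h \<in> K \<Longrightarrow> Q h \<le> Q w"
    using continuous_attains_sup[OF K _ cont] by auto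
  have "Q g \<le> Q w * (\<Sum>i<n. (g i)\<^sup>2)" if g: "(\<Sum>i<n. g i) = 0" for g
  proof (cases "(\<Sum>i<n. (g i)\<^sup>2) = 0")
    case True
    then have "\<And>j. j < n \<Longrightarrow> g j = 0"
      by (subst (asm) sum_nonneg_eq_0_iff) auto
    then have "Q g = 0" by (simp add: Q_def kernel_apply_def)
    with True show ?thesis by simp
  next
    case False
    define c where "c = sqrt (\<Sum>i<n. (g i)\<^sup>2)"
    have c2: "c\<^sup>2 = (\<Sum>i<n. (g i)\<^sup>2)" by (simp add: c_def sum_nonneg)
    obtain h where h: "h \<in> K" "\<And>i. i < n \<Longrightarrow> g i = c * h i"
      using scaled[OF g False] by (auto simp: c_def)
    have "Q g = c\<^sup>2 * Q h"
      by (simp add: Q_def kernel_apply_cong[of n g "\<lambda>i. c * h i", OF h(2)] kernel_apply_scale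
          power_mult_distrib sum_distrib_left)
    also have "\<dots> \<le> c\<^sup>2 * Q w" using w(2)[OF h(1)] by (intro mult_left_mono) auto
    finally show ?thesis by (simp add: c2 mult.commute)
  qed
  with w(1) show ?thesis
    by (intro that[of w]) (auto simp: K_def Q_def)
qed

text \<open>For small \<open>t\<close> of sign opposite to \<open>b\<close> the linear term would
  win and make the expression negative.\<close>

lemma linear_term_zero_if_quadratic_nonneg:
  fixes b c :: real
  assumes "\<And>t. 0 \<le> 2 * t * b + t\<^sup>2 * c"
  shows "b = 0"
proof (rule ccontr)
  assume b: "b \<noteq> 0"
  \<comment> \<open>The minimiser of the majorant
    \<open>2 * t * b + t\<^sup>2 * (1 + \<bar>c\<bar>)\<close>; the added 1 keeps the denominator
    nonzero.\<close>
  define t where "t = - b / (1 + \<bar>c\<bar>)"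
  have t: "t * (1 + \<bar>c\<bar>) = - b" by (simp add: t_def)
  have "0 \<le> 2 * t * b + t\<^sup>2 * c" by (rule assms)
  also have "\<dots> \<le> 2 * t * b + t\<^sup>2 * (1 + \<bar>c\<bar>)"
    by (intro add_left_mono mult_left_mono) auto
  also have "t\<^sup>2 * (1 + \<bar>c\<bar>) = - (t * b)"
    using t by (metis mult.assoc mult_minus_right power2_eq_square)
  also have "2 * t * b + - (t * b) = t * b" by simp
  also have "\<dots> = - (b\<^sup>2 / (1 + \<bar>c\<bar>))" by (simp add: t_def power2_eq_square)
  also have "\<dots> < 0" using b by (simp add: add_pos_nonneg)
  finally show False by simp
qed

text \<open>First-order stationarity at a maximiser \<open>w\<close> of the norm of
  \<open>A w\<close> gives \<open>A (A w) = M w\<close>, where \<open>M\<close> is the maximal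
  squared norm. Factoring \<open>A\<^sup>2 - M\<close> then leaves an eigenvector for a square root
  \<open>r\<close> of \<open>M\<close>.\<close>

lemma extremal_eigenvector:
  fixes a :: "nat \<Rightarrow> nat \<Rightarrow> real" and f :: "nat \<Rightarrow> real"
  assumes sym: "\<And>i j. i < n \<Longrightarrow> j < n \<Longrightarrow> a i j = a j i"
    and row: "\<And>i. i < n \<Longrightarrow> (\<Sum>j<n. a i j) = D"
    and f: "(\<Sum>i<n. f i) = 0" "(\<Sum>i<n. (f i)\<^sup>2) \<noteq> 0"
  obtains w r where "(\<Sum>i<n. w i) = 0" "\<exists>i<n. w i \<noteq> 0"
    "\<And>i. i < n \<Longrightarrow> kernel_apply n a w i = r * w i"
    "\<And>g. (\<Sum>i<n. g i) = 0 \<Longrightarrow> (\<Sum>i<n. (kernel_apply n a g i)\<^sup>2) \<le> r\<^sup>2 * (\<Sum>i<n. (g i)\<^sup>2)"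
proof -
  let ?A = "kernel_apply n a"
  obtain w where w: "(\<Sum>i<n. w i) = 0" "(\<Sum>i<n. (w i)\<^sup>2) = 1"
    and max: "\<And>g. (\<Sum>i<n. g i) = 0 \<Longrightarrow>
       (\<Sum>i<n. (?A g i)\<^sup>2) \<le> (\<Sum>i<n. (?A w i)\<^sup>2) * (\<Sum>i<n. (g i)\<^sup>2)"
    using kernel_apply_max_on_sphere[OF f, of a] by metis
  define M where "M = (\<Sum>i<n. (?A w i)\<^sup>2)"
  have M: "M \<ge> 0" unfolding M_def by (intro sum_nonneg) auto
  \<comment> \<open>The residual of the desired equation serves as its own test direction: the polar
    form at \<open>(w, g)\<close> comes out as the squared norm of \<open>g\<close>.\<close>
  define g where "g i = M * w i - ?A (?A w) i" for i
  have sumA: "(\<Sum>i<n. ?A h i) = D * (\<Sum>i<n. h i)" for h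
    by (rule sum_kernel_apply[OF sym row])
  have g0: "(\<Sum>i<n. g i) = 0"
    by (simp add: g_def sum_subtractf sum_distrib_left[symmetric] sumA w)
  define b where "b = M * (\<Sum>i<n. w i * g i) - (\<Sum>i<n. ?A w i * ?A g i)"
  define c where "c = M * (\<Sum>i<n. (g i)\<^sup>2) - (\<Sum>i<n. (?A g i)\<^sup>2)"
  \<comment> \<open>The form \<open>M |h|\<^sup>2 - |A h|\<^sup>2\<close> is nonnegative on the complement of the constants and vanishes
    at \<open>w\<close>, hence \<open>w\<close> lies in its kernel; \<open>b\<close> is the polar form at \<open>(w, g)\<close>.\<close>
  have "b = 0"
  proof (rule linear_term_zero_if_quadratic_nonneg)
    fix t :: real
    have "(\<Sum>i<n. w i + t * g i) = 0"
      by (simp add: sum.distrib sum_distrib_left[symmetric] w g0)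
    from max[OF this, folded M_def]
    have "0 \<le> M * (\<Sum>i<n. (w i + t * g i)\<^sup>2) - (\<Sum>i<n. (?A w i + t * ?A g i)\<^sup>2)"
      by (simp add: kernel_apply_add kernel_apply_scale)
    also have "(\<Sum>i<n. (w i + t * g i)\<^sup>2) = 1 + 2 * t * (\<Sum>i<n. w i * g i) + t\<^sup>2 * (\<Sum>i<n. (g i)\<^sup>2)"
      by (simp add: w(2)[symmetric] power2_sum sum.distrib sum_distrib_left power_mult_distrib mult_ac)
    also have "(\<Sum>i<n. (?A w i + t * ?A g i)\<^sup>2)
      = M + 2 * t * (\<Sum>i<n. ?A w i * ?A g i) + t\<^sup>2 * (\<Sum>i<n. (?A g i)\<^sup>2)"
      by (simp add: M_def power2_sum sum.distrib sum_distrib_left power_mult_distrib mult_ac)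
    finally show "0 \<le> 2 * t * b + t\<^sup>2 * c"
      by (simp add: b_def c_def algebra_simps)
  qed
  moreover have "b = (\<Sum>i<n. (g i)\<^sup>2)"
  proof -
    have "b = M * (\<Sum>i<n. w i * g i) - (\<Sum>i<n. ?A (?A w) i * g i)"
      by (simp add: b_def kernel_apply_adjoint[of n a "?A w" g, OF sym])
    also have "\<dots> = (\<Sum>i<n. (M * w i - ?A (?A w) i) * g i)"
      by (simp add: sum_distrib_left sum_subtractf left_diff_distrib mult.assoc)
    finally show ?thesis by (simp add: g_def power2_eq_square)
  qed
  ultimately have "\<And>i. i < n \<Longrightarrow> g i = 0"
    using sum_nonneg_eq_0_iff[of "{..<n}" "\<lambda>i. (g i)\<^sup>2"] by auto
  then have AA: "\<And>i. i < n \<Longrightarrow> ?A (?A w) i = M * w i" by (simp add: g_def)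
  have "\<exists>i<n. w i \<noteq> 0" using w(2) by (auto intro: ccontr)
  define s where "s = sqrt M"
  have s: "s\<^sup>2 = M" using M by (simp add: s_def)
  \<comment> \<open>\<open>A\<^sup>2 w = s\<^sup>2 w\<close> means \<open>(A - s) v = 0\<close> for \<open>v = (A + s) w\<close>.\<close>
  define v where "v = (\<lambda>i. ?A w i + s * w i)"
  show thesis
  proof (cases "\<exists>i<n. v i \<noteq> 0")
    case True
    have "?A v i = s * v i" if "i < n" for i
      using AA[OF that] s
      by (simp add: v_def kernel_apply_add kernel_apply_scale algebra_simps power2_eq_square)
    moreover have "(\<Sum>i<n. v i) = 0"
      by (simp add: v_def sum.distrib sum_distrib_left[symmetric] sumA w)
    ultimately show ?thesis using that[of v s] True max s by (simp add: M_def)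
  next
    \<comment> \<open>Here \<open>(A + s) w = 0\<close>, so \<open>w\<close> itself is an
      eigenvector, for \<open>- s\<close>.\<close>
    case False
    then have "?A w i = (- s) * w i" if "i < n" for i
      using that by (auto simp: v_def add_eq_0_iff2)
    then show ?thesis using that[of w "- s"] w \<open>\<exists>i<n. w i \<noteq> 0\<close> max s by (simp add: M_def)
  qed
qed

text \<open>Compare both sides of the eigenvalue equation at a coordinate where
  \<open>\<bar>w i\<bar>\<close> is largest.\<close>

lemma eigenvalue_le_row_sum:
  fixes a :: "nat \<Rightarrow> nat \<Rightarrow> real"
  assumes nonneg: "\<And>i j. i < n \<Longrightarrow> j < n \<Longrightarrow> a i j \<ge> 0"
    and row: "\<And>i. i < n \<Longrightarrow> (\<Sum>j<n. a i j) = D"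
    and w: "\<exists>i<n. w i \<noteq> 0" "\<And>i. i < n \<Longrightarrow> kernel_apply n a w i = r * w i"
  shows "\<bar>r\<bar> \<le> D"
proof -
  define m where "m = Max ((\<lambda>i. \<bar>w i\<bar>) ` {..<n})"
  have le: "\<bar>w i\<bar> \<le> m" if "i < n" for i unfolding m_def using that by auto
  have "m \<in> (\<lambda>i. \<bar>w i\<bar>) ` {..<n}" unfolding m_def using w(1) by (intro Max_in) auto
  then obtain i where i: "i < n" "\<bar>w i\<bar> = m" by auto
  have "m > 0" using w(1) le by force
  have "\<bar>r\<bar> * m = \<bar>kernel_apply n a w i\<bar>" using i w(2) by (simp add: abs_mult)
  also have "\<dots> \<le> (\<Sum>j<n. \<bar>a i j * w j\<bar>)" unfolding kernel_apply_def by (rule sum_abs)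
  also have "\<dots> \<le> (\<Sum>j<n. a i j * m)"
    by (intro sum_mono) (use le nonneg i(1) in \<open>auto simp: abs_mult intro!: mult_left_mono\<close>)
  also have "\<dots> = D * m" using row[OF i(1)] by (simp add: sum_distrib_right[symmetric])
  finally show ?thesis using \<open>m > 0\<close> by simp
qed

section \<open>Real-rootedness and deflation of the characteristic polynomial\<close>

text \<open>In the basis \<open>(1,\<dots>,1), e\<^sub>1, \<dots>, e\<^sub>m\<close> the matrix becomes block upper triangular
  with diagonal blocks \<open>D\<close> and \<open>(A\<^sub>i\<^sub>j - A\<^sub>0\<^sub>j)\<close>.\<close>

lemma char_poly_constant_row_sum:
  fixes A :: "real mat"
  assumes A: "A \<in> carrier_mat (Suc m) (Suc m)"
    and row: "\<And>i. i < Suc m \<Longrightarrow> (\<Sum>j<Suc m. A $$ (i, j)) = D"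
  shows "char_poly A = [:-D, 1:] *
    char_poly (mat m m (\<lambda>(i, j). A $$ (Suc i, Suc j) - A $$ (0, Suc j)))"
proof -
  \<comment> \<open>The columns of \<open>P\<close> are the new basis, and \<open>Q\<close> is its
    inverse.\<close>
  define P Q :: "real mat" where
    "P = mat (Suc m) (Suc m) (\<lambda>(i, j). if j = 0 \<or> i = j then 1 else 0)"
    and "Q = mat (Suc m) (Suc m) (\<lambda>(i, j). if i = j then 1 else if j = 0 then - 1 else 0)"
  define A1 A2 B :: "real mat" where "A1 = mat 1 1 (\<lambda>_. D)"
    and "A2 = mat 1 m (\<lambda>(i, j). A $$ (0, Suc j))"
    and "B = mat m m (\<lambda>(i, j). A $$ (Suc i, Suc j) - A $$ (0, Suc j))"
  \<comment> \<open>The lower left block is zero because the constant vector is an eigenvector. The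
    differences in \<open>B\<close> arise since a vector \<open>X\<close> has coordinate
    \<open>X i - X 0\<close> at \<open>e\<^sub>i\<close>.\<close>
  define M where "M = four_block_mat A1 A2 (0\<^sub>m m 1) B"
  have carr: "P \<in> carrier_mat (Suc m) (Suc m)" "Q \<in> carrier_mat (Suc m) (Suc m)"
    "A1 \<in> carrier_mat 1 1" "A2 \<in> carrier_mat 1 m" "B \<in> carrier_mat m m"
    by (auto simp: P_def Q_def A1_def A2_def B_def)
  have "M \<in> carrier_mat (1 + m) (1 + m)"
    unfolding M_def by (rule four_block_carrier_mat) (use carr in auto)
  then have M: "M \<in> carrier_mat (Suc m) (Suc m)" by simp
  have P_row: "(\<Sum>k<Suc m. P $$ (i, k) * X k) = (if i = 0 then 0 else X i) + X 0"
    if "i < Suc m" for i and X :: "nat \<Rightarrow> real"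
  proof -
    have "(\<Sum>k<Suc m. P $$ (i, k) * X k) = X 0 + (\<Sum>k<m. if i = Suc k then X i else 0)"
      unfolding sum.lessThan_Suc_shift using that
      by (intro arg_cong2[of _ _ _ _ "(+)"] sum.cong) (auto simp: P_def)
    also have "(\<Sum>k<m. if i = Suc k then X i else 0) = (if i = 0 then 0 else X i)"
      using that by (cases i) auto
    finally show ?thesis by simp
  qed
  have Q_row: "(\<Sum>k<Suc m. Q $$ (i, k) * X k) = (if i = 0 then X 0 else X i - X 0)"
    if "i < Suc m" for i and X :: "nat \<Rightarrow> real"
  proof -
    have "(\<Sum>k<Suc m. Q $$ (i, k) * X k) =
      (if i = 0 then 1 else - 1) * X 0 + (\<Sum>k<m. if i = Suc k then X i else 0)"
      unfolding sum.lessThan_Suc_shift using that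
      by (intro arg_cong2[of _ _ _ _ "(+)"] sum.cong) (auto simp: Q_def)
    also have "(\<Sum>k<m. if i = Suc k then X i else 0) = (if i = 0 then 0 else X i)"
      using that by (cases i) auto
    finally show ?thesis by simp
  qed
  have mult: "(X * Y) $$ (i, j) = (\<Sum>k<Suc m. X $$ (i, k) * Y $$ (k, j))"
    if "X \<in> carrier_mat (Suc m) (Suc m)" "Y \<in> carrier_mat (Suc m) (Suc m)" "i < Suc m" "j < Suc m"
    for X Y :: "real mat" and i j
    using that by (simp add: scalar_prod_def atLeast0LessThan del: sum.lessThan_Suc)
  have "P * Q = 1\<^sub>m (Suc m)"
    by (rule eq_matI) (use carr in \<open>auto simp: mult P_row Q_def simp del: sum.lessThan_Suc index_mult_mat(1)\<close>)
  moreover have "Q * P = 1\<^sub>m (Suc m)"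
    by (rule eq_matI) (use carr in \<open>auto simp: mult Q_row P_def simp del: sum.lessThan_Suc index_mult_mat(1)\<close>)
  moreover have "A * P = P * M"
  proof (rule eq_matI)
    fix i j assume "i < dim_row (P * M)" "j < dim_col (P * M)"
    then have ij: "i < Suc m" "j < Suc m" using carr M by auto
    have Mij: "M $$ (k, j) = (if j = 0 then if k = 0 then D else 0
       else if k = 0 then A $$ (0, j) else A $$ (k, j) - A $$ (0, j))" if "k < Suc m" for k
      using that ij carr by (cases k; cases j) (auto simp: M_def A1_def A2_def B_def)
    have "(A * P) $$ (i, j) = (\<Sum>k<Suc m. A $$ (i, k) * (if j = 0 \<or> k = j then 1 else 0))"
      unfolding mult[OF A carr(1) ij] using ij by (intro sum.cong) (auto simp: P_def)
    also have "\<dots> = (if j = 0 then D else A $$ (i, j))"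
      using row[OF ij(1)] ij
      by (simp add: if_distrib cong: if_cong del: sum.lessThan_Suc)
    also have "\<dots> = (P * M) $$ (i, j)"
      using ij by (simp add: mult[OF carr(1) M] P_row Mij del: sum.lessThan_Suc index_mult_mat(1))
    finally show "(A * P) $$ (i, j) = (P * M) $$ (i, j)" .
  qed (use A M carr in auto)
  then have "A = P * M * Q"
    using \<open>P * Q = 1\<^sub>m (Suc m)\<close> A carr by (metis assoc_mult_mat right_mult_one_mat)
  ultimately have "similar_mat A M"
    using A M carr by (intro similar_matI[of _ _ P Q "Suc m"]) auto
  then have "char_poly A = char_poly A1 * char_poly B"
    unfolding M_def
    by (metis char_poly_similar char_poly_four_block_zeros_col[OF carr(3-5)])
  moreover have "char_poly A1 = [:-D, 1:]"
    by (simp add: A1_def char_poly_defs det_def sign_def)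
  ultimately show ?thesis by (simp add: B_def)
qed

lemma eigenvalueI:
  fixes A :: "'a :: comm_ring_1 mat"
  assumes "A \<in> carrier_mat n n"
    and "\<And>i. i < n \<Longrightarrow> (\<Sum>j<n. A $$ (i, j) * w j) = r * w i"
    and "i < n" "w i \<noteq> 0"
  shows "eigenvalue A r"
  unfolding eigenvalue_def eigenvector_def
proof (intro exI[of _ "vec n w"] conjI)
  show "vec n w \<noteq> 0\<^sub>v (dim_row A)"
  proof
    assume "vec n w = 0\<^sub>v (dim_row A)"
    then have "vec n w $ i = 0\<^sub>v (dim_row A) $ i" by simp
    with assms show False by simp
  qed
  show "A *\<^sub>v vec n w = r \<cdot>\<^sub>v vec n w"
    by (rule eq_vecI) (use assms in \<open>auto simp: scalar_prod_def atLeast0LessThan\<close>)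
qed (use assms in auto)

text \<open>Subtracting \<open>w 0\<close> turns \<open>w\<close> into an eigenvector of the
  deflated block, nonzero because a constant vector of sum 0 vanishes. So \<open>r\<close> is a root
  beside the split-off \<open>D\<close>, and the value is counted twice if
  \<open>r = D\<close>.\<close>

lemma proots_constant_row_sum:
  fixes A :: "real mat"
  assumes A: "A \<in> carrier_mat n n"
    and row: "\<And>i. i < n \<Longrightarrow> (\<Sum>j<n. A $$ (i, j)) = D"
    and w: "(\<Sum>i<n. w i) = 0" "\<exists>i<n. w i \<noteq> 0"
      "\<And>i. i < n \<Longrightarrow> (\<Sum>j<n. A $$ (i, j) * w j) = r * w i"
  shows "{#D, r#} \<subseteq># proots (char_poly A)"
proof (cases n)
  case (Suc m)
  define B where "B = mat m m (\<lambda>(i, j). A $$ (Suc i, Suc j) - A $$ (0, Suc j))"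
  have B: "B \<in> carrier_mat m m" by (simp add: B_def)
  have cp: "char_poly A = [:-D, 1:] * char_poly B"
    unfolding B_def by (rule char_poly_constant_row_sum) (use A row Suc in auto)
  have "\<exists>i<m. w (Suc i) - w 0 \<noteq> 0"
  proof (rule ccontr)
    assume "\<not> ?thesis"
    then have const: "w i = w 0" if "i < n" for i using that Suc by (cases i) auto
    have "(\<Sum>i<n. w i) = (\<Sum>i<n. w 0)" by (intro sum.cong refl const) simp
    then have "w 0 = 0" using w(1) Suc by simp
    then show False using w(2) const by metis
  qed
  then obtain i where i: "i < m" "w (Suc i) - w 0 \<noteq> 0" by auto
  have "eigenvalue B r"
  proof (rule eigenvalueI[where w = "\<lambda>i. w (Suc i) - w 0", OF B _ i])
    fix i assume i: "i < m"
    \<comment> \<open>The added column \<open>j = 0\<close> contributes nothing, as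
      \<open>w 0 - w 0 = 0\<close>; equal row sums then cancel the correction by
      \<open>w 0\<close>.\<close>
    have "(\<Sum>j<m. B $$ (i, j) * (w (Suc j) - w 0))
      = (\<Sum>j<n. (A $$ (Suc i, j) - A $$ (0, j)) * (w j - w 0))"
      using i by (simp add: Suc sum.lessThan_Suc_shift B_def del: sum.lessThan_Suc)
    also have "\<dots> = (\<Sum>j<n. A $$ (Suc i, j) * w j) - (\<Sum>j<n. A $$ (0, j) * w j)
      - w 0 * ((\<Sum>j<n. A $$ (Suc i, j)) - (\<Sum>j<n. A $$ (0, j)))"
      by (simp add: algebra_simps sum.distrib sum_subtractf sum_distrib_left)
    also have "\<dots> = r * w (Suc i) - r * w 0"
    proof -
      have "Suc i < n" "0 < n" using i Suc by auto
      then show ?thesis by (simp add: w(3) row)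
    qed
    finally show "(\<Sum>j<m. B $$ (i, j) * (w (Suc j) - w 0)) = r * (w (Suc i) - w 0)"
      by (simp add: algebra_simps)
  qed
  then have "poly (char_poly B) r = 0" using eigenvalue_root_char_poly[OF B] by simp
  moreover have B0: "char_poly B \<noteq> 0" using degree_monic_char_poly[OF B] by auto
  ultimately have "r \<in># proots (char_poly B)" by simp
  moreover have "proots (char_poly A) = {#D#} + proots (char_poly B)"
    unfolding cp using B0 by (subst proots_mult) (auto simp: proots_linear_factor)
  ultimately show ?thesis by simp
qed (use w in auto)

section \<open>Real roots of symmetric matrices\<close>

text \<open>The Hermitian form \<open>q\<close> at the eigenvector equals \<open>z\<close> times a
  positive real and is its own conjugate.\<close>

lemma hermitian_eigenvalue_real:
  fixes A :: "complex mat"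
  assumes A: "A \<in> carrier_mat n n"
    and herm: "\<And>i j. i < n \<Longrightarrow> j < n \<Longrightarrow> A $$ (j, i) = cnj (A $$ (i, j))"
    and ev: "eigenvalue A z"
  shows "z \<in> \<real>"
proof -
  obtain v where v: "v \<in> carrier_vec n" "v \<noteq> 0\<^sub>v n" "A *\<^sub>v v = z \<cdot>\<^sub>v v"
    using ev A by (auto simp: eigenvalue_def eigenvector_def)
  have Av: "(\<Sum>j<n. A $$ (i, j) * v $ j) = z * v $ i" if "i < n" for i
    using arg_cong[OF v(3), of "\<lambda>u. u $ i"] that A v(1)
    by (simp add: scalar_prod_def atLeast0LessThan)
  define N where "N = (\<Sum>i<n. (cmod (v $ i))\<^sup>2)"
  define q where "q = (\<Sum>i<n. \<Sum>j<n. cnj (v $ i) * A $$ (i, j) * v $ j)"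
  have "q = (\<Sum>i<n. cnj (v $ i) * (z * v $ i))"
    by (simp add: q_def mult.assoc sum_distrib_left[symmetric] Av)
  also have "\<dots> = z * of_real N"
    by (simp add: N_def complex_norm_square sum_distrib_left mult_ac del: of_real_power)
  finally have q: "q = z * of_real N" .
  have "cnj q = (\<Sum>i<n. \<Sum>j<n. v $ i * A $$ (j, i) * cnj (v $ j))"
    by (simp add: q_def herm[symmetric])
  also have "\<dots> = q"
    by (subst sum.swap) (simp add: q_def mult_ac)
  finally have "cnj z * of_real N = z * of_real N" by (simp add: q)
  moreover have "N \<noteq> 0"
  proof
    assume "N = 0"
    then have "\<And>i. i < n \<Longrightarrow> v $ i = 0"
      unfolding N_def by (subst (asm) sum_nonneg_eq_0_iff) auto
    then have "v = 0\<^sub>v n" using v(1) by (intro eq_vecI) auto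
    with v(2) show False by simp
  qed
  ultimately show ?thesis by (simp add: Reals_cnj_iff)
qed

text \<open>The fundamental theorem of algebra supplies a complex root, real by hypothesis, so a
  linear factor splits off. Roots of the quotient are roots of \<open>p\<close>, which keeps the
  induction going.\<close>

lemma size_proots_real_rooted:
  fixes p :: "real poly"
  assumes "\<And>z. poly (map_poly of_real p) z = 0 \<Longrightarrow> z \<in> (\<real> :: complex set)" "p \<noteq> 0"
  shows "size (proots p) = degree p"
  using assms
proof (induction "degree p" arbitrary: p)
  case 0
  then show ?case using size_proots_le[of p] by simp
next
  case (Suc d)
  have "\<not> constant (poly (map_poly complex_of_real p))"
    using Suc(2) by (simp add: constant_degree)
  then obtain z where z: "poly (map_poly complex_of_real p) z = 0"
    using fundamental_theorem_of_algebra by blast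
  then obtain x where x: "z = of_real x" using Suc(3) by (auto elim: Reals_cases)
  have "poly p x = 0" using z unfolding x by simp
  then obtain q where q: "p = [:-x, 1:] * q" by (auto simp: poly_eq_0_iff_dvd elim: dvdE)
  have q0: "q \<noteq> 0" using Suc(4) q by auto
  have deg: "degree p = Suc (degree q)" unfolding q using q0 by (subst degree_mult_eq) auto
  interpret map_hom: map_poly_comm_ring_hom complex_of_real ..
  have "map_poly complex_of_real p = map_poly complex_of_real [:-x, 1:] * map_poly of_real q"
    unfolding q by (rule map_hom.hom_mult)
  then have "size (proots q) = degree q"
    using Suc(2,3) deg q0 by (intro Suc(1)) auto
  then show ?case
    unfolding deg unfolding q using q0 by (subst proots_mult) auto
qed

text \<open>Complex roots of the characteristic polynomial are eigenvalues of a Hermitian matrix.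
  The count makes \<open>n - 1\<close> the last index of \<open>eigenvalues_desc A\<close>.\<close>

lemma size_proots_char_poly_symmetric:
  fixes A :: "real mat"
  assumes A: "A \<in> carrier_mat n n"
    and sym: "\<And>i j. i < n \<Longrightarrow> j < n \<Longrightarrow> A $$ (i, j) = A $$ (j, i)"
  shows "size (proots (char_poly A)) = n"
proof -
  have deg: "degree (char_poly A) = n" and ne: "char_poly A \<noteq> 0"
    using degree_monic_char_poly[OF A] by auto
  define C where "C = map_mat complex_of_real A"
  have C: "C \<in> carrier_mat n n" using A by (simp add: C_def)
  have "size (proots (char_poly A)) = degree (char_poly A)"
  proof (rule size_proots_real_rooted[OF _ ne])
    fix z :: complex assume "poly (map_poly of_real (char_poly A)) z = 0"
    then have "eigenvalue C z"
      unfolding eigenvalue_root_char_poly[OF C] by (simp add: C_def of_real_hom.char_poly_hom[OF A])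
    then show "z \<in> \<real>"
      by (rule hermitian_eigenvalue_real[OF C, rotated]) (use A sym in \<open>auto simp: C_def\<close>)
  qed
  then show ?thesis using deg by simp
qed

section \<open>Positions in the decreasing list of roots\<close>

text \<open>Two members counted with multiplicity cannot both sit at the head only, so one of them
  is at most the second entry, and \<open>b\<close> is the smaller.\<close>

lemma second_of_sorted_desc:
  fixes M :: "'a :: linorder multiset"
  assumes "{#a, b#} \<subseteq># M" "b \<le> a"
  shows "b \<le> rev (sorted_list_of_multiset M) ! 1"
proof -
  define L where "L = rev (sorted_list_of_multiset M)"
  have mset: "mset L = M" by (simp add: L_def)
  have "size {#a, b#} \<le> size M" by (rule size_mset_mono) fact
  then have "length L \<ge> 2" by (simp add: mset[symmetric])
  then obtain x y L' where L: "L = x # y # L'"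
    by (cases L; cases "tl L") auto
  have "sorted (rev L)" by (simp add: L_def)
  then have sorted: "\<And>z. z \<in> set L' \<Longrightarrow> z \<le> y"
    by (auto simp: L sorted_append)
  have sub: "{#a, b#} \<subseteq># add_mset x (mset (y # L'))" using assms(1) mset by (simp add: L)
  \<comment> \<open>Otherwise both equal the head \<open>x\<close>, which would require a second
    copy in the tail.\<close>
  have "a \<in> set (y # L') \<or> b \<in> set (y # L')"
  proof (rule ccontr)
    assume neg: "\<not> ?thesis"
    then have "a = x" "b = x" using mset_subset_eqD[OF sub, of a] mset_subset_eqD[OF sub, of b] by auto
    then show False using sub neg by auto
  qed
  then have "b \<le> y"
    using sorted assms(2) by (auto intro: order_trans)
  then show ?thesis by (simp add: L_def[symmetric] L)
qed

text \<open>Index \<open>n - 1\<close> after reversal is the head of the increasing list, hence the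
  minimum.\<close>

lemma last_of_sorted_desc:
  fixes M :: "'a :: linorder multiset"
  assumes "a \<in># M" "size M = n"
  shows "rev (sorted_list_of_multiset M) ! (n - 1) \<le> a"
proof -
  define L where "L = sorted_list_of_multiset M"
  have mset: "mset L = M" by (simp add: L_def)
  then have "a \<in> set L" "length L = n" using assms by (auto simp: size_mset[symmetric] simp del: size_mset)
  moreover have "sorted L" by (simp add: L_def)
  ultimately show ?thesis
    unfolding L_def[symmetric] by (cases L) (auto simp: nth_append)
qed

section \<open>The norm bound by the second and the last eigenvalue\<close>

lemma norm_bound_orthogonal_to_constants:
  fixes A :: "real mat"
  assumes A: "A \<in> carrier_mat n n"
    and nonneg: "\<And>i j. i < n \<Longrightarrow> j < n \<Longrightarrow> A $$ (i, j) \<ge> 0"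
    and sym: "\<And>i j. i < n \<Longrightarrow> j < n \<Longrightarrow> A $$ (i, j) = A $$ (j, i)"
    and row: "\<And>i. i < n \<Longrightarrow> (\<Sum>j<n. A $$ (i, j)) = D"
    and f: "(\<Sum>i<n. f i) = 0"
    and lam: "lam = max (eigenvalues_desc A ! 1) \<bar>eigenvalues_desc A ! (n - 1)\<bar>"
  shows "(\<Sum>i<n. (\<Sum>j<n. A $$ (i, j) * f j)\<^sup>2) \<le> lam\<^sup>2 * (\<Sum>i<n. (f i)\<^sup>2)"
\<comment> \<open>A zero \<open>f\<close> gives no unit vector to start from. This case absorbs
  \<open>n \<le> 1\<close>, where index 1 lies outside the list of eigenvalues.\<close>
proof (cases "(\<Sum>i<n. (f i)\<^sup>2) = 0")
  case True
  then have "\<And>j. j < n \<Longrightarrow> f j = 0"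
    by (subst (asm) sum_nonneg_eq_0_iff) auto
  then show ?thesis by simp
next
  case False
  define a where "a i j = A $$ (i, j)" for i j
  have a_sym: "a i j = a j i" if "i < n" "j < n" for i j
    using sym[OF that] by (simp add: a_def)
  have a_row: "(\<Sum>j<n. a i j) = D" if "i < n" for i
    using row[OF that] by (simp add: a_def)
  obtain w r where w: "(\<Sum>i<n. w i) = 0" "\<exists>i<n. w i \<noteq> 0"
    "\<And>i. i < n \<Longrightarrow> kernel_apply n a w i = r * w i"
    and bound: "\<And>g. (\<Sum>i<n. g i) = 0 \<Longrightarrow>
      (\<Sum>i<n. (kernel_apply n a g i)\<^sup>2) \<le> r\<^sup>2 * (\<Sum>i<n. (g i)\<^sup>2)"
    using extremal_eigenvector[OF a_sym a_row f False] by metis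
  have "\<bar>r\<bar> \<le> D"
    by (rule eigenvalue_le_row_sum[of n a, OF _ _ w(2,3)]) (use nonneg row in \<open>auto simp: a_def\<close>)
  have roots: "{#D, r#} \<subseteq># proots (char_poly A)"
    by (rule proots_constant_row_sum[OF A row w(1,2)])
      (use w(3) in \<open>auto simp: kernel_apply_def a_def\<close>)
  \<comment> \<open>A nonnegative \<open>r\<close> stands beside \<open>D\<close> with
    \<open>r \<le> D\<close>, so it is at most the entry at index 1. A negative \<open>r\<close> is
    at least the last entry, which is then negative and no smaller in absolute value.\<close>
  have "\<bar>r\<bar> \<le> lam"
  proof (cases "r \<ge> 0")
    case True
    then show ?thesis
      using second_of_sorted_desc[OF roots] \<open>\<bar>r\<bar> \<le> D\<close> by (simp add: lam eigenvalues_desc_def)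
  next
    case False
    have "r \<in># proots (char_poly A)" by (rule mset_subset_eqD[OF roots]) simp
    from last_of_sorted_desc[OF this size_proots_char_poly_symmetric[OF A sym]] False
    show ?thesis by (simp add: lam eigenvalues_desc_def)
  qed
  then have "r\<^sup>2 \<le> lam\<^sup>2" by (simp add: abs_le_square_iff[symmetric])
  then have "r\<^sup>2 * (\<Sum>i<n. (f i)\<^sup>2) \<le> lam\<^sup>2 * (\<Sum>i<n. (f i)\<^sup>2)"
    by (intro mult_right_mono) (auto intro: sum_nonneg)
  with bound[OF f] show ?thesis by (simp add: kernel_apply_def a_def)
qed

section \<open>Neighborhoods in regular hypergraphs\<close>

text \<open>Double counting of pairs \<open>(u, e)\<close> with \<open>u\<close> and
  \<open>v\<close> in \<open>e\<close>: each of the \<open>d\<close> hyperedges at \<open>v\<close>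
  offers \<open>k - 1\<close> choices of \<open>u\<close>.\<close>

lemma adjacency_row_sum:
  assumes reg: "regular_hypergraph d k V E" and v: "v \<in> V"
  shows "(\<Sum>u\<in>V - {v}. real (card {e \<in> E. v \<in> e \<and> u \<in> e})) = real d * (real k - 1)"
proof -
  have V: "finite V" and e: "\<And>e. e \<in> E \<Longrightarrow> e \<subseteq> V \<and> card e = k"
    and deg: "card {e \<in> E. v \<in> e} = d"
    using reg v by (auto simp: regular_hypergraph_def hypergraph_def)
  have "finite E" using finite_subset[of E "Pow V"] V e by auto
  then have fin: "finite {e \<in> E. v \<in> e}" by simp
  have "(\<Sum>u\<in>V - {v}. real (card {e \<in> E. v \<in> e \<and> u \<in> e}))
    = (\<Sum>u\<in>V - {v}. \<Sum>e | e \<in> E \<and> v \<in> e. if u \<in> e then 1 else 0)"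
    using fin by (intro sum.cong refl) (simp add: sum.If_cases Int_def conj_assoc)
  also have "\<dots> = (\<Sum>e | e \<in> E \<and> v \<in> e. \<Sum>u\<in>V - {v}. if u \<in> e then 1 else 0)"
    by (rule sum.swap)
  also have "\<dots> = (\<Sum>e | e \<in> E \<and> v \<in> e. real k - 1)"
  proof (intro sum.cong refl)
    fix e' assume e': "e' \<in> {e \<in> E. v \<in> e}"
    then have "finite e'" using e V finite_subset by blast
    have "(V - {v}) \<inter> {u. u \<in> e'} = e' - {v}" using e' e by auto
    then have "(\<Sum>u\<in>V - {v}. if u \<in> e' then 1 else 0 :: real) = real (card (e' - {v}))"
      using V by (simp add: sum.If_cases)
    also have "\<dots> = real (card e') - 1"
      using e' \<open>finite e'\<close> card_Suc_Diff1[of e' v] by auto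
    finally show "(\<Sum>u\<in>V - {v}. if u \<in> e' then 1 else 0) = real k - 1" using e e' by simp
  qed
  finally show ?thesis using deg by simp
qed

text \<open>As \<open>vs\<close> has no repetitions, indexing is a bijection; this moves sums
  between matrix indices and vertices.\<close>

lemma sum_nth_indices:
  assumes "distinct vs" "X \<subseteq> set vs"
  shows "(\<Sum>i | i < length vs \<and> vs ! i \<in> X. f (vs ! i)) = (\<Sum>v\<in>X. f v)"
proof (rule sum.reindex_bij_betw)
  show "bij_betw ((!) vs) {i. i < length vs \<and> vs ! i \<in> X} X"
    using assms by (auto simp: bij_betw_def inj_on_def nth_eq_iff_index_eq in_set_conv_nth image_iff subset_iff)
qed

theorem mainTheorem2:
  fixes V :: "'a set" and E :: "'a set set" and S :: "'a set"
    and vs :: "'a list" and d k n :: nat and \<mu> :: "real list" and lam :: real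
  assumes "regular_hypergraph d k V E"
    and "d \<ge> 1" and "k \<ge> 2"
    and "n = card V"
    and "distinct vs" and "set vs = V"
    and "\<mu> = eigenvalues_desc (adjacency_matrix E vs)"
    and "lam = max (\<mu> ! 1) \<bar>\<mu> ! (n - 1)\<bar>"
    and "S \<noteq> {}" and "S \<subseteq> V"
  shows "real (card (neighborhood V E S)) / real (card S) \<ge>
    1 / (1 - (1 - lam\<^sup>2 / ((real d)\<^sup>2 * (real k - 1)\<^sup>2)) * (1 - real (card S) / real n))"
proof -
  note vs = \<open>distinct vs\<close> \<open>set vs = V\<close>
  have n: "n = length vs" using vs \<open>n = card V\<close> by (metis distinct_card)
  define A where "A = adjacency_matrix E vs"
  have A: "A \<in> carrier_mat n n" by (simp add: A_def adjacency_matrix_def n)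
  have entry: "A $$ (i, j) = (if i = j then 0 else real (card {e \<in> E. vs ! i \<in> e \<and> vs ! j \<in> e}))"
    if "i < n" "j < n" for i j
    using that by (simp add: A_def adjacency_matrix_def n)
  define D where "D = real d * (real k - 1)"
  have D: "D > 0" using \<open>d \<ge> 1\<close> \<open>k \<ge> 2\<close> by (simp add: D_def)
  have nonneg: "A $$ (i, j) \<ge> 0" if "i < n" "j < n" for i j
    using entry[OF that] by simp
  have sym: "A $$ (i, j) = A $$ (j, i)" if "i < n" "j < n" for i j
    using that by (simp add: entry conj_commute)
  have row: "(\<Sum>j<n. A $$ (i, j)) = D" if i: "i < n" for i
  proof -
    have "vs ! i \<in> V" using i vs n by auto
    have "(\<Sum>j<n. A $$ (i, j)) = (\<Sum>j | j < length vs \<and> vs ! j \<in> V - {vs ! i}. A $$ (i, j))"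
      by (rule sum.mono_neutral_right) (use i vs n entry in \<open>auto simp: nth_eq_iff_index_eq\<close>)
    also have "\<dots> = (\<Sum>j | j < length vs \<and> vs ! j \<in> V - {vs ! i}.
        real (card {e \<in> E. vs ! i \<in> e \<and> vs ! j \<in> e}))"
      by (intro sum.cong refl) (use i n entry in auto)
    also have "\<dots> = (\<Sum>u\<in>V - {vs ! i}. real (card {e \<in> E. vs ! i \<in> e \<and> u \<in> e}))"
      by (rule sum_nth_indices[where f = "\<lambda>u. real (card {e \<in> E. vs ! i \<in> e \<and> u \<in> e})"])
        (use vs in auto)
    also have "\<dots> = D"
      unfolding D_def by (rule adjacency_row_sum[OF assms(1) \<open>vs ! i \<in> V\<close>])
    finally show ?thesis .
  qed
  define N where "N = neighborhood V E S"
  define s where "s = real (card S)"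
  have "finite V" using vs by auto
  then have "finite S" using \<open>S \<subseteq> V\<close> finite_subset by blast
  have s: "s > 0" using \<open>S \<noteq> {}\<close> \<open>finite S\<close> by (simp add: s_def card_gt_0_iff)
  have sn: "s \<le> real n"
    using card_mono[OF \<open>finite V\<close> \<open>S \<subseteq> V\<close>] \<open>n = card V\<close> by (simp add: s_def)
  have npos: "real n > 0" using s sn by simp
  define x where "x i = (if vs ! i \<in> S then 1 else 0 :: real)" for i
  have sum_x: "(\<Sum>i<n. x i) = s"
  proof -
    have "(\<Sum>i<n. x i) = (\<Sum>i | i < length vs \<and> vs ! i \<in> S. 1)"
      by (simp add: x_def sum.If_cases n Int_def)
    also have "\<dots> = s"
      using sum_nth_indices[of vs S "\<lambda>_. 1 :: real"] vs \<open>S \<subseteq> V\<close> by (simp add: s_def)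
    finally show ?thesis .
  qed
  \<comment> \<open>The mean of the indicator \<open>x\<close>; \<open>f\<close> is the part of
    \<open>x\<close> orthogonal to the constants.\<close>
  define t where "t = s / n"
  have nt: "n * t = s" using npos by (simp add: t_def)
  have t: "0 < t" "t \<le> 1" using s sn npos by (auto simp: t_def)
  define f where "f i = x i - t" for i
  have sum_f: "(\<Sum>i<n. f i) = 0"
    by (simp add: f_def sum_subtractf sum_x nt)
  \<comment> \<open>Squaring fixes \<open>x i\<close>, which is 0 or 1.\<close>
  have "(f i)\<^sup>2 = x i - 2 * t * x i + t\<^sup>2" for i
    by (simp add: f_def x_def power2_eq_square algebra_simps)
  then have "(\<Sum>i<n. (f i)\<^sup>2) = (\<Sum>i<n. x i) - 2 * t * (\<Sum>i<n. x i) + n * t\<^sup>2"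
    by (simp add: sum.distrib sum_subtractf sum_distrib_left)
  then have sum_f2: "(\<Sum>i<n. (f i)\<^sup>2) = s * (1 - t)"
    using nt by (simp add: sum_x power2_eq_square algebra_simps)
  define Af where "Af i = (\<Sum>j<n. A $$ (i, j) * f j)" for i
  define Ax where "Ax i = (\<Sum>j<n. A $$ (i, j) * x j)" for i
  have sum_A: "(\<Sum>i<n. \<Sum>j<n. A $$ (i, j) * g j) = D * (\<Sum>i<n. g i)" for g
    using sum_kernel_apply[of n "\<lambda>i j. A $$ (i, j)" D g] sym row by (simp add: kernel_apply_def)
  have Ax: "Ax i = Af i + D * t" if "i < n" for i
    using row[OF that]
    by (simp add: Ax_def Af_def f_def right_diff_distrib sum_subtractf sum_distrib_right[symmetric])
  \<comment> \<open>Pythagoras: the cross term drops out because the entries of \<open>Af\<close>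
    sum to 0.\<close>
  have "(\<Sum>i<n. (Ax i)\<^sup>2) = (\<Sum>i<n. (Af i)\<^sup>2 + 2 * (D * t) * Af i + (D * t)\<^sup>2)"
    by (intro sum.cong refl) (simp add: Ax power2_sum algebra_simps)
  also have "\<dots> = (\<Sum>i<n. (Af i)\<^sup>2) + 2 * (D * t) * (\<Sum>i<n. Af i) + n * (D * t)\<^sup>2"
    by (simp add: sum.distrib sum_distrib_left)
  also have "(\<Sum>i<n. Af i) = 0" using sum_A[of f] by (simp add: Af_def sum_f)
  also have "(\<Sum>i<n. (Af i)\<^sup>2) \<le> lam\<^sup>2 * (\<Sum>i<n. (f i)\<^sup>2)"
    unfolding Af_def
    by (rule norm_bound_orthogonal_to_constants[OF A nonneg sym row sum_f])
      (use assms in \<open>simp_all add: A_def\<close>)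
  also have "n * (D * t)\<^sup>2 = D\<^sup>2 * s * t"
    using nt by (simp add: power2_eq_square mult_ac)
  finally have upper: "(\<Sum>i<n. (Ax i)\<^sup>2) \<le> lam\<^sup>2 * (s * (1 - t)) + D\<^sup>2 * s * t"
    by (simp add: sum_f2)
  define I where "I = {i. i < length vs \<and> vs ! i \<in> N}"
  have I: "finite I" "I \<subseteq> {..<n}" by (auto simp: I_def n)
  have "real (card I) = real (card N)"
    using sum_nth_indices[of vs N "\<lambda>_. 1 :: real"] vs
    by (auto simp: I_def N_def neighborhood_def)
  \<comment> \<open>A nonzero term needs a hyperedge joining vertex \<open>i\<close> to a vertex of
    \<open>S\<close>, which would put \<open>vs ! i\<close> into \<open>N\<close>.\<close>
  have outside: "Ax i = 0" if "i < n" "i \<notin> I" for i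
    unfolding Ax_def
  proof (intro sum.neutral ballI)
    fix j assume "j \<in> {..<n}"
    then have j: "j < n" by simp
    have "vs ! i \<in> V" using that(1) vs n by auto
    then have "{e \<in> E. vs ! i \<in> e \<and> vs ! j \<in> e} = {}" if "vs ! j \<in> S"
      using \<open>i \<notin> I\<close> \<open>i < n\<close> that by (auto simp: I_def N_def neighborhood_def n)
    then show "A $$ (i, j) * x j = 0"
      using entry[OF that(1) j] by (auto simp: x_def simp del: Collect_empty_eq)
  qed
  have "D * s = (\<Sum>i<n. Ax i)" using sum_A[of x] by (simp add: Ax_def sum_x)
  also have "\<dots> = (\<Sum>i\<in>I. Ax i)"
    by (rule sum.mono_neutral_right) (use I outside in auto)
  finally have "(D * s)\<^sup>2 = (\<Sum>i\<in>I. Ax i)\<^sup>2" by simp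
  \<comment> \<open>Cauchy--Schwarz over the support only, so that the factor is the size of
    \<open>N\<close> and not \<open>n\<close>.\<close>
  also have "\<dots> \<le> (\<Sum>i\<in>I. (Ax i)\<^sup>2) * card I"
    by (rule sum_squared_le_sum_of_squares)
  also have "(\<Sum>i\<in>I. (Ax i)\<^sup>2) \<le> (\<Sum>i<n. (Ax i)\<^sup>2)"
    by (rule sum_mono2) (use I in auto)
  also note upper
  finally have main: "D\<^sup>2 * s\<^sup>2 \<le> (lam\<^sup>2 * (s * (1 - t)) + D\<^sup>2 * s * t) * card N"
    using \<open>real (card I) = real (card N)\<close> by (simp add: power_mult_distrib mult_right_mono)
  define y where "y = lam\<^sup>2 / D\<^sup>2"
  have y: "y \<ge> 0" by (simp add: y_def)
  define q where "q = 1 - (1 - y) * (1 - t)"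
  \<comment> \<open>In this form the denominator of the claim is visibly positive, since
    \<open>0 < t \<le> 1\<close> and \<open>y \<ge> 0\<close>.\<close>
  have q_eq: "q = t + y * (1 - t)" by (simp add: q_def algebra_simps)
  then have q: "q > 0" using t y by (simp add: add_pos_nonneg)
  have "lam\<^sup>2 * (s * (1 - t)) + D\<^sup>2 * s * t = D\<^sup>2 * s * q"
    using D by (simp add: q_eq y_def field_simps)
  with main have "(D\<^sup>2 * s) * s \<le> (D\<^sup>2 * s) * (q * card N)"
    by (simp add: power2_eq_square mult_ac)
  then have "s \<le> q * card N" using D s by simp
  then have "1 / q \<le> card N / s" using q s by (simp add: field_simps)
  then show ?thesis
    by (simp add: q_def y_def D_def t_def s_def N_def power_mult_distrib)
qed

end
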